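(* Let $N\ge1$, $\varepsilon>0$ and $\beta\in(-\pi,0)$, and let $(\Theta(t),K(t))_{t\ge0}$, $\Theta=(\theta_1,\dots,\theta_N)\in\mathbb R^N$, $K=(\kappa_{ij})\in\mathbb R^{N\times N}$, be the solution of $$\dot\theta_i=-\frac1N\sum_{j=1}^N\kappa_{ij}\sin(\theta_i-\theta_j),\qquad \dot\kappa_{ij}=-\varepsilon\big(\sin(\theta_i-\theta_j+\beta)+\kappa_{ij}\big),\qquad i,j\in[N],$$ with initial data $(\Theta^0,K^0)$. Suppose that $$\mathcal D^0<\min(\pi+\beta,|\beta|)<\frac{\pi}{2}\qquad\text{and}\qquad \min_{i,j\in[N]}\kappa_{ij}^0>0.$$ Then $$\lim_{t\to\infty}\mathcal D(t)=0\qquad\text{and}\qquad \lim_{t\to\infty}\kappa_{ij}(t)=-\sin\beta\quad\text{for all } i,j\in[N].$$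
   Context: $[N]=\{1,\dots,N\}$. The phase diameter is $\mathcal D(t)=\max_{i\in[N]}\theta_i(t)-\min_{i\in[N]}\theta_i(t)$, and $\mathcal D^0=\mathcal D(0)$. *)

theory Defs
  imports "HOL-Analysis.Analysis"
begin

text \<open>The index set \<open>[N]\<close> is a finite type \<open>'n\<close>, so that \<open>N = CARD('n) \<ge> 1\<close>, and
  \<open>K t $ i $ j\<close> is the entry \<open>\<kappa>\<^sub>i\<^sub>j(t)\<close>. The derivatives are taken
  within \<open>{0..}\<close>, that is, one-sided at the initial time; nothing is assumed for negative times.\<close>

definition adaptive_kuramoto_solution ::
    "real \<Rightarrow> real \<Rightarrow> (real \<Rightarrow> real ^ 'n) \<Rightarrow> (real \<Rightarrow> real ^ 'n ^ 'n) \<Rightarrow> bool" where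
  "adaptive_kuramoto_solution \<epsilon> \<beta> \<Theta> K \<longleftrightarrow>
    (\<forall>t\<ge>0. \<forall>i.
      ((\<lambda>s. \<Theta> s $ i) has_real_derivative
        - (1 / real CARD('n)) * (\<Sum>j\<in>UNIV. K t $ i $ j * sin (\<Theta> t $ i - \<Theta> t $ j)))
      (at t within {0..})) \<and>
    (\<forall>t\<ge>0. \<forall>i j.
      ((\<lambda>s. K s $ i $ j) has_real_derivative
        - \<epsilon> * (sin (\<Theta> t $ i - \<Theta> t $ j + \<beta>) + K t $ i $ j))
      (at t within {0..}))"

definition phase_diameter :: "real ^ 'n \<Rightarrow> real" where
  "phase_diameter \<theta> = (MAX i. \<theta> $ i) - (MIN i. \<theta> $ i)"

end

theory Submission
  imports Defs "HOL-Real_Asymp.Real_Asymp"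
begin

text \<open>Everything follows from a first-contact argument. Choose \<open>D\<^sup>0 < \<delta> < min (\<pi> + \<beta>) \<bar>\<beta>\<bar>\<close>. As long
  as all phase differences are at most \<open>\<delta>\<close>, the numbers \<open>- sin (\<theta>\<^sub>i - \<theta>\<^sub>j + \<beta>)\<close> are bounded below by a
  positive constant, which keeps every \<open>\<kappa>\<^sub>i\<^sub>j\<close> above some \<open>c > 0\<close>; conversely, couplings above \<open>c\<close>
  keep the phase differences strictly below \<open>\<delta> e\<^sup>-\<^sup>\<rho>\<^sup>t\<close>. Neither bound can be the first to fail.
  Hence the phase differences decay exponentially, and the linear equations for \<open>\<kappa>\<^sub>i\<^sub>j\<close>, whose
  forcing tends to \<open>- sin \<beta>\<close> exponentially, give the convergence of the couplings.\<close>

section \<open>Barrier principle for a finite family of functions\<close>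

text \<open>At the earliest zero of any member, all members are still nonnegative by continuity. The
  positive derivative from \<open>contact\<close> would make the vanishing member negative just
  before, contradicting minimality. Since \<open>contact\<close> may use all the weak bounds at
  once, mutually dependent bounds can be proved together.\<close>

lemma first_contact:
  fixes h h' :: "'k \<Rightarrow> real \<Rightarrow> real"
  assumes "finite I"
    and deriv: "\<And>k t. k \<in> I \<Longrightarrow> 0 \<le> t \<Longrightarrow> (h k has_real_derivative h' k t) (at t within {0..})"
    and init: "\<And>k. k \<in> I \<Longrightarrow> h k 0 > 0"
    and contact: "\<And>k t. k \<in> I \<Longrightarrow> 0 < t \<Longrightarrow> (\<And>l. l \<in> I \<Longrightarrow> h l t \<ge> 0) \<Longrightarrow> h k t = 0 \<Longrightarrow> h' k t > 0"
    and "k \<in> I" "0 \<le> t"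
  shows "h k t > 0"
proof (rule ccontr)
  assume neg: "\<not> h k t > 0"
  define S where "S = (\<Union>k\<in>I. {t\<in>{0..}. h k t \<le> 0})"
  have cont: "continuous_on {0..} (h k)" if "k \<in> I" for k
    using DERIV_continuous_on[OF deriv[OF that]] by simp
  have "closed S"
    unfolding S_def using \<open>finite I\<close>
    by (intro closed_UN continuous_on_closed_Collect_le cont ballI continuous_on_const) auto
  moreover have "S \<noteq> {}" "bdd_below S"
    using neg assms(5,6) unfolding S_def by (force, intro bdd_belowI[of _ 0], auto)
  ultimately have "Inf S \<in> S"
    by (intro closed_contains_Inf)
  then obtain j where j: "j \<in> I" "Inf S \<ge> 0" "h j (Inf S) \<le> 0"
    by (auto simp: S_def)
  define T where "T = Inf S"
  \<comment> \<open>A contact time away from 0 has a left neighbourhood in the domain, and there the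
    one-sided derivatives are ordinary ones.\<close>
  have "T \<noteq> 0"
    using init[of j] j by (auto simp: T_def)
  then have "T > 0"
    using j by (simp add: T_def)
  have before: "h l s > 0" if "l \<in> I" "0 \<le> s" "s < T" for l s
  proof (rule ccontr)
    assume "\<not> h l s > 0"
    then have "s \<in> S"
      using that by (auto simp: S_def intro!: bexI[of _ l])
    then show False
      using cInf_lower[OF _ \<open>bdd_below S\<close>, of s] that by (simp add: T_def)
  qed
  have at_T: "(h l has_real_derivative h' l T) (at T)" if "l \<in> I" for l
    using deriv[OF that, of T] at_within_interior[of T "{0..}"] \<open>T > 0\<close> by simp
  have nonneg: "h l T \<ge> 0" if "l \<in> I" for l
  proof -
    have "(h l \<longlongrightarrow> h l T) (at_left T)"
      using DERIV_isCont[OF at_T[OF that]] by (simp add: isCont_def filterlim_at_split)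
    moreover have "eventually (\<lambda>s. h l s \<ge> 0) (at_left T)"
      using eventually_at_left_real[OF \<open>T > 0\<close>]
      by eventually_elim (use before[OF that] in \<open>auto intro: less_imp_le\<close>)
    ultimately show ?thesis
      by (intro tendsto_lowerbound[of "h l" "h l T" "at_left T" 0]) auto
  qed
  have "h j T = 0"
    using nonneg[OF j(1)] j by (simp add: T_def)
  then have "h' j T > 0"
    by (intro contact j \<open>T > 0\<close> nonneg)
  then obtain d where d: "d > 0" "\<And>s. 0 < s \<Longrightarrow> s < d \<Longrightarrow> h j (T - s) < h j T"
    using DERIV_pos_inc_left[OF at_T[OF j(1)]] by blast
  define s where "s = min (d / 2) (T / 2)"
  have "h j (T - s) < 0"
    using d(2)[of s] d(1) \<open>T > 0\<close> \<open>h j T = 0\<close> by (simp add: s_def min_def)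
  moreover have "h j (T - s) > 0"
    using \<open>T > 0\<close> d(1) by (intro before j) (auto simp: s_def)
  ultimately show False
    by simp
qed

section \<open>Elementary sine estimates\<close>

lemma sin_add_le_sin_plus_sin:
  fixes a b :: real
  assumes "0 \<le> a" "a \<le> pi" "0 \<le> b" "b \<le> pi"
  shows "sin (a + b) \<le> sin a + sin b"
proof -
  have "sin a * cos b \<le> sin a * 1" "cos a * sin b \<le> 1 * sin b"
    using assms by (intro mult_left_mono mult_right_mono sin_ge_zero cos_le_one; simp)+
  then show ?thesis
    by (simp add: sin_add)
qed

text \<open>By the mean value theorem \<open>sin x = x * cos z\<close> with
  \<open>z < x \<le> d\<close>, and cosine decreases on [0, pi]. This linear lower bound is what
  yields an exponential rate.\<close>

lemma mult_cos_le_sin: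
  fixes x d :: real
  assumes "0 \<le> x" "x \<le> d" "d \<le> pi"
  shows "x * cos d \<le> sin x"
proof (cases "x = 0")
  case False
  then obtain z where z: "0 < z" "z < x" "sin x - sin 0 = (x - 0) * cos z"
    using MVT2[of 0 x sin cos] assms by (auto intro: derivative_eq_intros)
  then have "cos d \<le> cos z"
    using assms by (intro cos_monotone_0_pi_le) auto
  then show ?thesis
    using z assms by (simp add: mult_left_mono)
qed simp

lemma sin_le_sin_middle:
  fixes y \<eta> :: real
  assumes "0 \<le> \<eta>" "\<eta> \<le> y" "y \<le> pi - \<eta>"
  shows "sin \<eta> \<le> sin y"
proof (cases "y \<le> pi / 2")
  case True
  then show ?thesis
    using assms by (intro sin_monotone_2pi_le) auto
next
  case False
  then have "sin \<eta> \<le> sin (pi - y)"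
    using assms by (intro sin_monotone_2pi_le) auto
  then show ?thesis
    by simp
qed

lemma abs_sin_diff_le: "\<bar>sin x - sin y\<bar> \<le> \<bar>x - y\<bar>" for x y :: real
proof -
  have "norm (sin x - sin y) \<le> 1 * norm (x - y)"
    by (rule field_differentiable_bound[of UNIV sin cos]) (auto intro: DERIV_sin)
  then show ?thesis
    by simp
qed

section \<open>Linear relaxation under exponentially decaying forcing\<close>

text \<open>Where \<open>u\<close> touches the barrier, its slope is at most
  \<open>- \<epsilon> * (C - d) * exp (- \<mu> * t)\<close>. This is steeper than the barrier's own
  descent, because \<open>\<mu> * C \<le> \<epsilon> / 2 * C < \<epsilon> * (C - d)\<close>.\<close>

lemma relaxation_decay_upper:
  fixes u g :: "real \<Rightarrow> real"
  assumes "\<epsilon> > 0" "\<mu> \<le> \<epsilon> / 2"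
    and deriv: "\<And>t. 0 \<le> t \<Longrightarrow> (u has_real_derivative - \<epsilon> * (g t + u t)) (at t within {0..})"
    and forcing: "\<And>t. 0 \<le> t \<Longrightarrow> \<bar>g t\<bar> \<le> d * exp (- \<mu> * t)"
    and "C > u 0" "C > 2 * d" "C > 0" "0 \<le> t"
  shows "u t < C * exp (- \<mu> * t)"
proof -
  have "0 < C * exp (- \<mu> * t) - u t"
  proof (rule first_contact[where I = "{()}" and k = "()"
        and h = "\<lambda>_ t. C * exp (- \<mu> * t) - u t"
        and h' = "\<lambda>_ t. - \<mu> * C * exp (- \<mu> * t) + \<epsilon> * (g t + u t)"])
    fix s :: real
    assume s: "0 < s" and "C * exp (- \<mu> * s) - u s = 0"
    then have u: "u s = C * exp (- \<mu> * s)"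
      by simp
    have "\<mu> * C \<le> \<epsilon> / 2 * C"
      using assms by (intro mult_right_mono) auto
    also have "\<dots> < \<epsilon> * (C - d)"
      using mult_strict_left_mono[OF \<open>C > 2 * d\<close> \<open>\<epsilon> > 0\<close>] by (simp add: algebra_simps)
    finally have "\<mu> * C * exp (- \<mu> * s) < \<epsilon> * (C - d) * exp (- \<mu> * s)"
      by simp
    also have "\<dots> = \<epsilon> * (u s - d * exp (- \<mu> * s))"
      by (simp add: u algebra_simps)
    also have "\<dots> \<le> \<epsilon> * (g s + u s)"
      using forcing[of s] s assms(1) by (intro mult_left_mono) auto
    finally show "0 < - \<mu> * C * exp (- \<mu> * s) + \<epsilon> * (g s + u s)"
      by simp
  next
    fix s :: real
    assume "0 \<le> s"
    show "((\<lambda>t. C * exp (- \<mu> * t) - u t) has_real_derivative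
        - \<mu> * C * exp (- \<mu> * s) + \<epsilon> * (g s + u s)) (at s within {0..})"
      by (rule derivative_eq_intros deriv[OF \<open>0 \<le> s\<close>] refl)+ (simp add: algebra_simps)
  qed (use assms in auto)
  then show ?thesis
    by simp
qed

lemma relaxation_tendsto_0:
  fixes u g :: "real \<Rightarrow> real"
  assumes "\<epsilon> > 0" "\<rho> > 0"
    and deriv: "\<And>t. 0 \<le> t \<Longrightarrow> (u has_real_derivative - \<epsilon> * (g t + u t)) (at t within {0..})"
    and forcing: "\<And>t. 0 \<le> t \<Longrightarrow> \<bar>g t\<bar> \<le> d * exp (- \<rho> * t)"
  shows "(u \<longlongrightarrow> 0) at_top"
proof -
  \<comment> \<open>The rate is capped at half the relaxation rate, as the barrier requires;
    \<open>C\<close> exceeds both \<open>u 0\<close> and \<open>- u 0\<close> as well as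
    \<open>2 * d\<close>.\<close>
  define \<mu> where "\<mu> = min \<rho> (\<epsilon> / 2)"
  define C where "C = \<bar>u 0\<bar> + 2 * \<bar>d\<bar> + 1"
  have "\<mu> > 0"
    using assms by (simp add: \<mu>_def)
  have "d \<ge> 0"
    using forcing[of 0] by simp
  have forcing': "\<bar>g t\<bar> \<le> d * exp (- \<mu> * t)" if "0 \<le> t" for t
  proof -
    have "\<mu> * t \<le> \<rho> * t"
      using that by (intro mult_right_mono) (auto simp: \<mu>_def)
    then have "d * exp (- \<rho> * t) \<le> d * exp (- \<mu> * t)"
      using \<open>d \<ge> 0\<close> by (intro mult_left_mono) auto
    then show ?thesis
      using forcing[OF that] by simp
  qed
  have "\<bar>u t\<bar> \<le> C * exp (- \<mu> * t)" if "0 \<le> t" for t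
  proof -
    have "u t < C * exp (- \<mu> * t)"
      by (rule relaxation_decay_upper[OF \<open>\<epsilon> > 0\<close> _ deriv forcing'])
        (use that in \<open>auto simp: \<mu>_def C_def\<close>)
    \<comment> \<open>By linearity \<open>- u\<close> solves the same equation with forcing
      \<open>- g\<close>.\<close>
    moreover have "- u t < C * exp (- \<mu> * t)"
    proof (rule relaxation_decay_upper[OF \<open>\<epsilon> > 0\<close>, where g = "\<lambda>t. - g t" and d = d])
      show "((\<lambda>t. - u t) has_real_derivative - \<epsilon> * (- g s + - u s)) (at s within {0..})"
        if "0 \<le> s" for s
        using DERIV_minus[OF deriv[OF that]] by (simp add: algebra_simps)
    qed (use that forcing' in \<open>auto simp: \<mu>_def C_def\<close>)
    ultimately show ?thesis
      by simp
  qed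
  then have "eventually (\<lambda>t. norm (u t) \<le> C * exp (- \<mu> * t)) at_top"
    by (intro eventually_mono[OF eventually_ge_at_top[of 0]]) auto
  moreover have "((\<lambda>t. C * exp (- \<mu> * t)) \<longlongrightarrow> 0) at_top"
    using \<open>\<mu> > 0\<close> by real_asymp
  ultimately show ?thesis
    by (rule Lim_null_comparison)
qed

section \<open>Phase diameter and pairwise differences\<close>

lemma phase_diff_le_phase_diameter: "\<theta> $ i - \<theta> $ j \<le> phase_diameter \<theta>"
  unfolding phase_diameter_def by (intro diff_mono Max_ge Min_le) auto

lemma phase_diameter_nonneg: "phase_diameter \<theta> \<ge> 0"
  using phase_diff_le_phase_diameter[of \<theta> undefined undefined] by simp

lemma phase_diameter_le:
  fixes \<theta> :: "real ^ 'n"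
  assumes "\<And>i j. \<theta> $ i - \<theta> $ j \<le> d"
  shows "phase_diameter \<theta> \<le> d"
proof -
  have "(MAX i. \<theta> $ i) \<in> range (\<lambda>i. \<theta> $ i)" "(MIN i. \<theta> $ i) \<in> range (\<lambda>i. \<theta> $ i)"
    by (intro Max_in Min_in; simp)+
  then obtain i j where "(MAX i. \<theta> $ i) = \<theta> $ i" "(MIN i. \<theta> $ i) = \<theta> $ j"
    by blast
  then show ?thesis
    using assms by (simp add: phase_diameter_def)
qed

section \<open>Simultaneous bounds on phases and couplings\<close>

lemma exponential_synchronization:
  fixes \<Theta> :: "real \<Rightarrow> real ^ 'n" and K :: "real \<Rightarrow> real ^ 'n ^ 'n"
  assumes "\<epsilon> > 0"
    and sol: "adaptive_kuramoto_solution \<epsilon> \<beta> \<Theta> K"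
    and \<delta>: "phase_diameter (\<Theta> 0) < \<delta>" "\<delta> < pi + \<beta>" "\<delta> < - \<beta>" "\<delta> < pi / 2"
    and pos: "\<And>i j. K 0 $ i $ j > 0"
  shows "\<exists>\<rho>>0. \<forall>t\<ge>0. \<forall>i j. \<Theta> t $ i - \<Theta> t $ j < \<delta> * exp (- \<rho> * t)"
proof -
  note phase = sol[unfolded adaptive_kuramoto_solution_def, THEN conjunct1, rule_format]
    and coupling = sol[unfolded adaptive_kuramoto_solution_def, THEN conjunct2, rule_format]
  have "\<delta> > 0"
    using phase_diameter_nonneg \<delta>(1) by (rule le_less_trans)
  \<comment> \<open>While all phase differences are at most \<open>\<delta>\<close>, the angle
    \<open>- \<beta> - (\<Theta> t $ i - \<Theta> t $ j)\<close> stays in [\<eta>, pi - \<eta>],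
    where sine is at least \<open>sin \<eta>\<close>.\<close>
  define \<eta> where "\<eta> = min (pi + \<beta>) (- \<beta>) - \<delta>"
  have \<eta>: "0 < \<eta>" "\<eta> < pi"
    using \<delta> \<open>\<delta> > 0\<close> by (auto simp: \<eta>_def)
  define m where "m = (MIN (i, j). K 0 $ i $ j)"
  \<comment> \<open>Halving puts \<open>c\<close> strictly below the initial couplings, so the bound
    starts out true, and strictly below \<open>sin \<eta>\<close>, so the forcing pushes a coupling
    at level \<open>c\<close> upwards.\<close>
  define c where "c = min m (sin \<eta>) / 2"
  have "m > 0"
    unfolding m_def using pos by (auto simp: Min_gr_iff)
  then have c: "c > 0" "c < sin \<eta>" "c < m"
    using sin_gt_zero[OF \<eta>] by (auto simp: c_def min_def)
  have c_K0: "c < K 0 $ i $ j" for i j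
    using c(3) Min_le[of "range (\<lambda>(i, j). K 0 $ i $ j)" "K 0 $ i $ j"] unfolding m_def by force
  have "cos \<delta> > 0"
    using \<delta> \<open>\<delta> > 0\<close> by (intro cos_gt_zero)
  \<comment> \<open>Couplings of at least \<open>c\<close> contract an extremal difference at rate
    at least \<open>c * cos \<delta>\<close>; half of it leaves the strictness needed at
    contact.\<close>
  define \<rho> where "\<rho> = c * cos \<delta> / 2"
  have \<rho>: "\<rho> > 0" "\<rho> < c * cos \<delta>"
    using c(1) \<open>cos \<delta> > 0\<close> by (simp_all add: \<rho>_def)
  define \<theta>' where
    "\<theta>' i t = - (1 / real CARD('n)) * (\<Sum>k\<in>UNIV. K t $ i $ k * sin (\<Theta> t $ i - \<Theta> t $ k))" for i t
  \<comment> \<open>The left summand indexes the phase bounds, the right one the coupling bounds.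
    Both orders of each pair occur, so absolute differences are controlled.\<close>
  define h :: "('n \<times> 'n) + ('n \<times> 'n) \<Rightarrow> real \<Rightarrow> real" where
    "h = case_sum (\<lambda>(i, j) t. \<delta> * exp (- \<rho> * t) - (\<Theta> t $ i - \<Theta> t $ j)) (\<lambda>(i, j) t. K t $ i $ j - c)"
  define h' :: "('n \<times> 'n) + ('n \<times> 'n) \<Rightarrow> real \<Rightarrow> real" where
    "h' = case_sum (\<lambda>(i, j) t. - \<rho> * (\<delta> * exp (- \<rho> * t)) - (\<theta>' i t - \<theta>' j t))
      (\<lambda>(i, j) t. - \<epsilon> * (sin (\<Theta> t $ i - \<Theta> t $ j + \<beta>) + K t $ i $ j))"
  have "h k t > 0" if "0 \<le> t" for k t
  proof (rule first_contact[where I = UNIV and h = h and h' = h'])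
    show "(h k has_real_derivative h' k t) (at t within {0..})" if "0 \<le> t" for k t
      using that unfolding h_def h'_def \<theta>'_def
      by (cases k) (auto intro!: derivative_eq_intros phase coupling)
    show "h k 0 > 0" for k
      using le_less_trans[OF phase_diff_le_phase_diameter \<delta>(1)] c_K0
      by (cases k) (auto simp: h_def)
    fix k and t :: real
    assume "0 < t" and nonneg: "\<And>l. l \<in> UNIV \<Longrightarrow> h l t \<ge> 0" and zero: "h k t = 0"
    define d where "d = \<delta> * exp (- \<rho> * t)"
    have d: "0 < d" "d \<le> \<delta>"
      using \<open>\<delta> > 0\<close> \<rho>(1) \<open>0 < t\<close> by (auto simp: d_def)
    have diff_le: "\<Theta> t $ i - \<Theta> t $ j \<le> d" for i j
      using nonneg[of "Inl (i, j)"] by (simp add: h_def d_def)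
    have K_ge: "K t $ i $ j \<ge> c" for i j
      using nonneg[of "Inr (i, j)"] by (simp add: h_def)
    show "h' k t > 0"
    proof (cases k)
      case (Inl p)
      obtain i j where p: "p = (i, j)"
        by (cases p)
      have ij: "\<Theta> t $ i - \<Theta> t $ j = d"
        using zero by (simp add: Inl p h_def d_def)
      \<comment> \<open>Up to the factor -1/N this is the derivative of the difference, with the
        second sine reversed so that every term is nonnegative.\<close>
      define S where "S = (\<Sum>k\<in>UNIV. K t $ i $ k * sin (\<Theta> t $ i - \<Theta> t $ k)
        + K t $ j $ k * sin (\<Theta> t $ k - \<Theta> t $ j))"
      have "c * d * cos \<delta> \<le> K t $ i $ k * sin (\<Theta> t $ i - \<Theta> t $ k)
          + K t $ j $ k * sin (\<Theta> t $ k - \<Theta> t $ j)" for k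
      proof -
        define a b where "a = \<Theta> t $ i - \<Theta> t $ k" and "b = \<Theta> t $ k - \<Theta> t $ j"
        \<comment> \<open>No difference exceeds \<open>d\<close>, so at contact phase
          \<open>i\<close> is maximal and phase \<open>j\<close> minimal, and every phase
          \<open>k\<close> lies between them.\<close>
        have ab: "a + b = d" "0 \<le> a" "a \<le> pi" "0 \<le> b" "b \<le> pi"
          using ij diff_le[of i k] diff_le[of k j] d \<delta> by (auto simp: a_def b_def)
        have "d * cos \<delta> \<le> sin d"
          using d \<delta> by (intro mult_cos_le_sin) auto
        also have "\<dots> \<le> sin a + sin b"
          using sin_add_le_sin_plus_sin[of a b] ab by simp
        finally have "c * (d * cos \<delta>) \<le> c * (sin a + sin b)"
          using c(1) by simp
        also have "\<dots> \<le> K t $ i $ k * sin a + K t $ j $ k * sin b"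
          using ab K_ge unfolding distrib_left
          by (intro add_mono mult_right_mono sin_ge_zero) auto
        finally show ?thesis
          by (simp add: a_def b_def)
      qed
      then have "real CARD('n) * (c * d * cos \<delta>) \<le> S"
        unfolding S_def by (intro sum_bounded_below) auto
      then have "c * d * cos \<delta> \<le> S / real CARD('n)"
        by (simp add: pos_le_divide_eq mult.commute)
      moreover have "\<theta>' i t - \<theta>' j t = - S / real CARD('n)"
      proof -
        have "K t $ j $ k * sin (\<Theta> t $ k - \<Theta> t $ j) = - (K t $ j $ k * sin (\<Theta> t $ j - \<Theta> t $ k))" for k
          using sin_minus[of "\<Theta> t $ j - \<Theta> t $ k"] by simp
        then show ?thesis
          by (simp add: S_def \<theta>'_def sum_subtractf diff_divide_distrib)
      qed
      moreover have "\<rho> * d < c * d * cos \<delta>"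
        using \<rho>(2) d(1) by simp
      ultimately show ?thesis
        by (simp add: Inl p h'_def d_def)
    next
      case (Inr p)
      obtain i j where p: "p = (i, j)"
        by (cases p)
      \<comment> \<open>At contact the coupling equals \<open>c\<close>, so its derivative is
        \<open>\<epsilon> * (sin y - c)\<close>, and
        \<open>sin y \<ge> sin \<eta> > c\<close>.\<close>
      define y where "y = - \<beta> - (\<Theta> t $ i - \<Theta> t $ j)"
      have "sin \<eta> \<le> sin y"
        using \<eta> d diff_le[of i j] diff_le[of j i]
        by (intro sin_le_sin_middle) (auto simp: y_def \<eta>_def)
      moreover have "sin (\<Theta> t $ i - \<Theta> t $ j + \<beta>) = - sin y"
        using sin_minus[of y] by (simp add: y_def algebra_simps)
      moreover have "K t $ i $ j = c"
        using zero by (simp add: Inr p h_def)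
      ultimately show ?thesis
        using c(2) \<open>\<epsilon> > 0\<close> by (simp add: Inr p h'_def mult_less_0_iff)
    qed
  qed (use that in auto)
  from this[of _ "Inl (_, _)"] show ?thesis
    using \<rho>(1) by (intro exI[of _ \<rho>]) (auto simp: h_def)
qed

section \<open>Convergence of the diameter and of the couplings\<close>

theorem theorem4p2:
  fixes \<epsilon> \<beta> :: real
    and \<Theta> :: "real \<Rightarrow> real ^ 'n" and K :: "real \<Rightarrow> real ^ 'n ^ 'n"
    and \<Theta>0 :: "real ^ 'n" and K0 :: "real ^ 'n ^ 'n"
  assumes "\<epsilon> > 0"
    and "\<beta> \<in> {-pi<..<0}"
    and "adaptive_kuramoto_solution \<epsilon> \<beta> \<Theta> K"
    and "\<Theta> 0 = \<Theta>0" and "K 0 = K0"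
    and "phase_diameter \<Theta>0 < min (pi + \<beta>) \<bar>\<beta>\<bar>"
    and "min (pi + \<beta>) \<bar>\<beta>\<bar> < pi / 2"
    and "(MIN (i, j). K0 $ i $ j) > 0"
  shows "((\<lambda>t. phase_diameter (\<Theta> t)) \<longlongrightarrow> 0) at_top \<and>
    (\<forall>i j. ((\<lambda>t. K t $ i $ j) \<longlongrightarrow> - sin \<beta>) at_top)"
proof -
  obtain \<delta> where \<delta>: "phase_diameter \<Theta>0 < \<delta>" "\<delta> < min (pi + \<beta>) \<bar>\<beta>\<bar>"
    using dense[OF assms(6)] by blast
  have "K 0 $ i $ j > 0" for i j
    using assms(5,8) Min_le[of "range (\<lambda>(i, j). K0 $ i $ j)" "K0 $ i $ j"] by force
  then obtain \<rho> where "\<rho> > 0"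
    and decay: "\<And>t i j. 0 \<le> t \<Longrightarrow> \<Theta> t $ i - \<Theta> t $ j < \<delta> * exp (- \<rho> * t)"
    using exponential_synchronization[OF assms(1,3), of \<delta>] \<delta> assms(2,4,7) by auto
  have "((\<lambda>t. phase_diameter (\<Theta> t)) \<longlongrightarrow> 0) at_top"
  proof (rule Lim_null_comparison)
    show "eventually (\<lambda>t. norm (phase_diameter (\<Theta> t)) \<le> \<delta> * exp (- \<rho> * t)) at_top"
      using eventually_ge_at_top[of 0]
    proof eventually_elim
      case (elim t)
      then have "phase_diameter (\<Theta> t) \<le> \<delta> * exp (- \<rho> * t)"
        by (intro phase_diameter_le less_imp_le[OF decay])
      then show ?case
        using phase_diameter_nonneg[of "\<Theta> t"] by simp
    qed
    show "((\<lambda>t. \<delta> * exp (- \<rho> * t)) \<longlongrightarrow> 0) at_top"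
      using \<open>\<rho> > 0\<close> by real_asymp
  qed
  moreover have "((\<lambda>t. K t $ i $ j) \<longlongrightarrow> - sin \<beta>) at_top" for i j
  proof -
    \<comment> \<open>Shifting by the limit gives a relaxation equation whose forcing vanishes at
      equal phases; as sine is 1-Lipschitz, it inherits the decay of the phase differences.\<close>
    have "((\<lambda>t. K t $ i $ j + sin \<beta>) \<longlongrightarrow> 0) at_top"
    proof (rule relaxation_tendsto_0[OF \<open>\<epsilon> > 0\<close> \<open>\<rho> > 0\<close>,
          where g = "\<lambda>t. sin (\<Theta> t $ i - \<Theta> t $ j + \<beta>) - sin \<beta>" and d = \<delta>])
      fix t :: real
      assume "0 \<le> t"
      then have "((\<lambda>t. K t $ i $ j) has_real_derivative
          - \<epsilon> * (sin (\<Theta> t $ i - \<Theta> t $ j + \<beta>) + K t $ i $ j)) (at t within {0..})"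
        using assms(3) by (simp add: adaptive_kuramoto_solution_def)
      then show "((\<lambda>t. K t $ i $ j + sin \<beta>) has_real_derivative
          - \<epsilon> * (sin (\<Theta> t $ i - \<Theta> t $ j + \<beta>) - sin \<beta> + (K t $ i $ j + sin \<beta>))) (at t within {0..})"
        by (auto intro!: derivative_eq_intros)
      show "\<bar>sin (\<Theta> t $ i - \<Theta> t $ j + \<beta>) - sin \<beta>\<bar> \<le> \<delta> * exp (- \<rho> * t)"
        using abs_sin_diff_le[of "\<Theta> t $ i - \<Theta> t $ j + \<beta>" \<beta>]
          decay[OF \<open>0 \<le> t\<close>, of i j] decay[OF \<open>0 \<le> t\<close>, of j i] by linarith
    qed
    from tendsto_add[OF this tendsto_const[of "- sin \<beta>"]] show ?thesis
      by simp
  qed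
  ultimately show ?thesis
    by blast
qed

end
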